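(* There is a function $\varepsilon:\mathbb{N}\to\mathbb{R}$ with $\varepsilon(d)\to 0$ as $d\to\infty$ such that for every integer $g\ge 3$ and every positive integer $d$ there exists a finite unit distance graph $G$ in $\mathbb{R}^d$ with girth at least $g$ and $\chi(G)\ge (1.074+\varepsilon(d))^d$. (In words: there exist unit distance graphs in $\mathbb{R}^d$ with chromatic number at least $(1.074+o(1))^d$ and arbitrarily large girth, where the $o(1)$ term does not depend on the girth.)
   Context: A graph $G$ is a unit distance graph in $\mathbb{R}^d$ if there is an injective map from $V(G)$ to $\mathbb{R}^d$ such that any two adjacent vertices are mapped to points at Euclidean distance exactly $1$ (non-adjacent vertices may also be at distance $1$; the representation need not be faithful). The girth of a graph is the length of its shortest cycle (infinite if there is no cycle). $\chi(G)$ denotes the chromatic number. *)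

theory Defs
  imports "HOL-Analysis.Analysis"
begin

definition finite_simple_graph :: "'a set \<Rightarrow> ('a \<Rightarrow> 'a \<Rightarrow> bool) \<Rightarrow> bool" where
  "finite_simple_graph V E \<longleftrightarrow> finite V \<and>
     (\<forall>u v. E u v \<longrightarrow> u \<in> V \<and> v \<in> V \<and> u \<noteq> v \<and> E v u)"

definition has_cycle_of_length :: "'a set \<Rightarrow> ('a \<Rightarrow> 'a \<Rightarrow> bool) \<Rightarrow> nat \<Rightarrow> bool" where
  "has_cycle_of_length V E k \<longleftrightarrow> 3 \<le> k \<and>
     (\<exists>vs. length vs = k \<and> distinct vs \<and> set vs \<subseteq> V \<and>
        (\<forall>i<k. E (vs ! i) (vs ! ((i + 1) mod k))))"

definition girth_at_least :: "'a set \<Rightarrow> ('a \<Rightarrow> 'a \<Rightarrow> bool) \<Rightarrow> nat \<Rightarrow> bool" where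
  "girth_at_least V E g \<longleftrightarrow> (\<forall>k<g. \<not> has_cycle_of_length V E k)"

definition colorable :: "'a set \<Rightarrow> ('a \<Rightarrow> 'a \<Rightarrow> bool) \<Rightarrow> nat \<Rightarrow> bool" where
  "colorable V E k \<longleftrightarrow> (\<exists>c :: 'a \<Rightarrow> nat. (\<forall>v\<in>V. c v < k) \<and>
     (\<forall>u\<in>V. \<forall>v\<in>V. E u v \<longrightarrow> c u \<noteq> c v))"

definition chromatic_number :: "'a set \<Rightarrow> ('a \<Rightarrow> 'a \<Rightarrow> bool) \<Rightarrow> nat" where
  "chromatic_number V E = (LEAST k. colorable V E k)"

text \<open>Points of R^d are represented as functions nat => real vanishing outside {..<d};
  Euclidean distance in R^d.\<close>
definition in_Rd :: "nat \<Rightarrow> (nat \<Rightarrow> real) \<Rightarrow> bool" where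
  "in_Rd d x \<longleftrightarrow> (\<forall>i\<ge>d. x i = 0)"

definition dist_Rd :: "nat \<Rightarrow> (nat \<Rightarrow> real) \<Rightarrow> (nat \<Rightarrow> real) \<Rightarrow> real" where
  "dist_Rd d x y = sqrt (\<Sum>i<d. (x i - y i)^2)"

definition unit_distance_graph :: "nat \<Rightarrow> 'a set \<Rightarrow> ('a \<Rightarrow> 'a \<Rightarrow> bool) \<Rightarrow> bool" where
  "unit_distance_graph d V E \<longleftrightarrow> (\<exists>p :: 'a \<Rightarrow> (nat \<Rightarrow> real).
     inj_on p V \<and> (\<forall>v\<in>V. in_Rd d (p v)) \<and>
     (\<forall>u\<in>V. \<forall>v\<in>V. E u v \<longrightarrow> dist_Rd d (p u) (p v) = 1))"

end

theory Submission
  imports Defs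
begin

text \<open>
  Start from a graph \<open>H\<close> with \<open>N\<close> vertices, independence number at most \<open>a\<close> and unit distance
  embedding into the complex space of dimension \<open>k\<close>, that is into real dimension \<open>2 k\<close>. Its Cartesian power
  with \<open>m\<close> factors embeds into the same space: send \<open>(x\<^sub>1, \<dots>, x\<^sub>m)\<close> to the sum of the
  \<open>c\<^sub>i z(x\<^sub>i)\<close>, where the \<open>c\<^sub>i\<close> are generic complex numbers of modulus one. A vertex set of density
  \<open>2 a / N\<close> in the power spans a positive proportion of all edges, because it does so on average on
  the lines of each direction. Keep every edge with probability \<open>C / m\<close>. For large \<open>m\<close> every
  such set still contains an edge, whereas short cycles become rare: a graph with \<open>n\<close> vertices and
  degrees at most \<open>D\<close> has at most \<open>n D\<^bsup>k - 1\<^esup>\<close> cycles of length \<open>k\<close>, each surviving with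
  probability \<open>(C / m)\<^bsup>k\<^esup>\<close>, and \<open>D\<close> is linear in \<open>m\<close>. Deleting a vertex of each short cycle
  leaves a graph of large girth and chromatic number at least \<open>N / (4 a)\<close>.

  For \<open>H\<close> take the Frankl-Wilson graph on the \<open>(2 q - 1)\<close>-subsets of an \<open>n\<close>-set, with two sets adjacent if
  they meet in \<open>q - 1\<close> points and \<open>q\<close> a power of two between \<open>0.08 n\<close> and \<open>0.16 n\<close>. It has
  \<open>N / a \<ge> 1.09\<^bsup>n\<^esup>\<close>, so the factor two between consecutive admissible \<open>q\<close> is harmless.
\<close>

section \<open>Sets with a forbidden intersection\<close>

text \<open>By absorption \<open>j * (2 ^ e choose j)\<close> is a multiple of \<open>2 ^ e\<close>;
  were the binomial odd, \<open>2 ^ e\<close> would divide the smaller positive number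
  \<open>j\<close>.\<close>

lemma even_binomial_power_of_two:
  assumes "0 < j" "j < 2 ^ e"
  shows "even ((2 ^ e :: nat) choose j)"
proof (rule ccontr)
  assume "odd ((2 ^ e :: nat) choose j)"
  then have "coprime (2 ^ e :: nat) ((2 ^ e) choose j)"
    by (simp add: coprime_left_2_iff_odd)
  moreover have "(2 ^ e :: nat) dvd j * ((2 ^ e) choose j)"
    using assms(1) by (metis Suc_pred binomial_absorption dvd_triv_left)
  ultimately have "(2 ^ e :: nat) dvd j"
    by (simp add: coprime_dvd_mult_left_iff)
  with assms show False by (auto dest: dvd_imp_le)
qed

text \<open>An instance of Lucas' theorem at the prime 2. For \<open>x = q + y\<close>, Vandermonde
  leaves modulo 2 only the term \<open>k = 0\<close>, since \<open>q choose k\<close> is even for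
  \<open>0 < k < q\<close>. Parity thus singles out the forbidden intersection size and the full
  size of a member.\<close>

lemma odd_binomial_iff_below_double:
  fixes q :: nat
  assumes q: "q = 2 ^ e" and x: "x < 2 * q"
  shows "odd (x choose (q - 1)) \<longleftrightarrow> x = q - 1 \<or> x = 2 * q - 1"
proof (cases "x < q")
  case True
  then show ?thesis
    by (cases "x = q - 1") (auto simp: binomial_eq_0)
next
  case False
  define y where "y = x - q"
  have y: "x = q + y" "y < q" using False x by (auto simp: y_def)
  have "x choose (q - 1) = (\<Sum>k\<le>q - 1. (q choose k) * (y choose (q - 1 - k)))"
    using vandermonde[of q y "q - 1"] y by simp
  also have "\<dots> = (y choose (q - 1)) + (\<Sum>k\<in>{..q - 1} - {0}. (q choose k) * (y choose (q - 1 - k)))"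
    by (subst sum.remove[of _ 0]) auto
  finally have eq: "x choose (q - 1) = \<dots>" .
  have "even (\<Sum>k\<in>{..q - 1} - {0}. (q choose k) * (y choose (q - 1 - k)))"
    by (intro dvd_sum) (use q even_binomial_power_of_two[of _ e] y in auto)
  then have "odd (x choose (q - 1)) \<longleftrightarrow> odd (y choose (q - 1))"
    unfolding eq by simp
  also have "\<dots> \<longleftrightarrow> y = q - 1"
    using y by (cases "y = q - 1") (auto simp: binomial_eq_0)
  finally show ?thesis using y by auto
qed

lemma odd_sum_iff_odd_card:
  assumes "finite A"
  shows "odd (\<Sum>x\<in>A. f x :: nat) \<longleftrightarrow> odd (card {x\<in>A. odd (f x)})"
  using assms even_sum_iff by blast

text \<open>
  Over the field with two elements, the incidence vectors of the members of \<open>F\<close> against the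
  \<open>(q - 1)\<close>-subsets are orthonormal. Their subset sums are therefore pairwise distinct, which
  gives an injection of \<open>Pow F\<close> into the power set of the \<open>(q - 1)\<close>-subsets.
\<close>
lemma card_forbidden_intersection_le:
  fixes q n :: nat
  assumes q: "q = 2 ^ e"
    and F: "F \<subseteq> {A. A \<subseteq> {..<n} \<and> card A = 2 * q - 1}"
    and forb: "\<And>A B. A \<in> F \<Longrightarrow> B \<in> F \<Longrightarrow> A \<noteq> B \<Longrightarrow> card (A \<inter> B) \<noteq> q - 1"
  shows "card F \<le> n choose (q - 1)"
proof -
  define Q where "Q = {S. S \<subseteq> {..<n} \<and> card S = q - 1}"
  define \<Phi> where "\<Phi> G = {S\<in>Q. odd (card {A\<in>G. S \<subseteq> A})}" for G
  have finQ: "finite Q" unfolding Q_def by simp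
  have finF: "finite F" by (rule finite_subset[OF F]) auto
  have q0: "0 < q" using q by simp
  \<comment> \<open>\<open>\<Phi> G\<close> is the sum modulo 2 of the incidence vectors of the
    members of \<open>G\<close>. Pairing it with the vector of \<open>A\<close> tells whether
    \<open>A\<close> is one of them, so \<open>G\<close> can be read off from
    \<open>\<Phi> G\<close>.\<close>
  have key: "odd (card {S\<in>\<Phi> G. S \<subseteq> A}) \<longleftrightarrow> A \<in> G" if G: "G \<subseteq> F" and A: "A \<in> F" for G A
  proof -
    have finG: "finite G" using G finF finite_subset by blast
    have cA: "card A = 2 * q - 1" "A \<subseteq> {..<n}" using A F by blast+
    have finA: "finite A" using cA(2) finite_subset by blast
    have "{S\<in>\<Phi> G. S \<subseteq> A} = {S\<in>{S\<in>Q. S \<subseteq> A}. odd (card {B\<in>G. S \<subseteq> B})}"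
      unfolding \<Phi>_def by auto
    then have "odd (card {S\<in>\<Phi> G. S \<subseteq> A}) \<longleftrightarrow> odd (\<Sum>S\<in>{S\<in>Q. S \<subseteq> A}. card {B\<in>G. S \<subseteq> B})"
      using odd_sum_iff_odd_card[of "{S\<in>Q. S \<subseteq> A}"] finQ by simp
    also have "(\<Sum>S\<in>{S\<in>Q. S \<subseteq> A}. card {B\<in>G. S \<subseteq> B})
        = (\<Sum>B\<in>G. card {S\<in>{S\<in>Q. S \<subseteq> A}. S \<subseteq> B})"
      by (rule sum_multicount_gen) (use finQ finG in auto)
    also have "\<dots> = (\<Sum>B\<in>G. card (A \<inter> B) choose (q - 1))"
    proof (rule sum.cong[OF refl])
      fix B
      have "{S\<in>{S\<in>Q. S \<subseteq> A}. S \<subseteq> B} = {S. S \<subseteq> A \<inter> B \<and> card S = q - 1}"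
        using cA(2) by (auto simp: Q_def)
      then show "card {S\<in>{S\<in>Q. S \<subseteq> A}. S \<subseteq> B} = card (A \<inter> B) choose (q - 1)"
        using n_subsets[of "A \<inter> B" "q - 1"] finA by simp
    qed
    finally have "odd (card {S\<in>\<Phi> G. S \<subseteq> A}) \<longleftrightarrow>
        odd (card {B\<in>G. odd (card (A \<inter> B) choose (q - 1))})"
      using odd_sum_iff_odd_card[OF finG] by simp
    \<comment> \<open>Distinct members meet in fewer than \<open>2 * q - 1\<close> points, which
      excludes one odd case; \<open>forb\<close> excludes the other.\<close>
    moreover have "odd (card (A \<inter> B) choose (q - 1)) \<longleftrightarrow> B = A" if B: "B \<in> G" for B
    proof (cases "B = A")
      case True
      then show ?thesis using cA q0 odd_binomial_iff_below_double[OF q, of "2 * q - 1"] by simp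
    next
      case False
      have BF: "B \<in> F" using B G by auto
      have cB: "card B = 2 * q - 1" "B \<subseteq> {..<n}" using BF F by blast+
      have "card (A \<inter> B) < card A"
      proof (rule psubset_card_mono[OF finA])
        have "finite B" using cB(2) finite_subset by blast
        then have "\<not> A \<subseteq> B" using False cA(1) cB(1) card_subset_eq[of B A] by auto
        then show "A \<inter> B \<subset> A" by auto
      qed
      then have "card (A \<inter> B) < 2 * q - 1" using cA by simp
      moreover have "card (A \<inter> B) \<noteq> q - 1" using forb[OF A BF] False by auto
      ultimately show ?thesis
        using odd_binomial_iff_below_double[OF q, of "card (A \<inter> B)"] False by simp
    qed
    then have "{B\<in>G. odd (card (A \<inter> B) choose (q - 1))} = {B\<in>G. B = A}" by blast
    moreover have "card {B\<in>G. B = A} = (if A \<in> G then 1 else 0)"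
      by (auto simp: Collect_conv_if conj_commute)
    ultimately show ?thesis by simp
  qed
  have "inj_on \<Phi> (Pow F)"
  proof (rule inj_onI)
    fix G G' assume "G \<in> Pow F" "G' \<in> Pow F" "\<Phi> G = \<Phi> G'"
    then show "G = G'" using key[of G] key[of G'] by auto
  qed
  then have "card (Pow F) \<le> card (Pow Q)"
    by (rule card_inj_on_le) (use finQ in \<open>auto simp: \<Phi>_def\<close>)
  then have "card F \<le> card Q"
    using finF finQ by (simp add: card_Pow)
  also have "card Q = n choose (q - 1)"
    unfolding Q_def using n_subsets[of "{..<n}"] by simp
  finally show ?thesis .
qed

section \<open>Exponential growth of a ratio of binomial coefficients\<close>

text \<open>Consecutive coefficients have quotient \<open>(n - j) / (j + 1)\<close>, which is at
  least \<open>r\<close> as long as \<open>j + 1 \<le> 2 * q\<close>; \<open>i\<close> such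
  quotients are multiplied.\<close>

lemma power_le_binomial_ratio:
  fixes r :: real
  assumes r: "0 \<le> r" "r * real (2 * q) \<le> real n - real (2 * q)" and i: "i \<le> q" and q: "0 < q"
  shows "r ^ i * real (n choose (q - 1)) \<le> real (n choose (q - 1 + i))"
  using i
proof (induction i)
  case 0
  then show ?case by simp
next
  case (Suc i)
  define j where "j = q - 1 + i"
  have "0 \<le> r * real (2 * q)" using r by simp
  then have n: "2 * q \<le> n" using r by linarith
  have j: "Suc j \<le> 2 * q" using Suc.prems q by (simp add: j_def)
  have "Suc j * (n choose Suc j) = (n - j) * (n choose j)"
    by (metis binomial_absorb_comp binomial_absorption)
  then have eq: "real (Suc j) * real (n choose Suc j) = (real n - real j) * real (n choose j)"
    using j n by (metis Suc_leD le_trans of_nat_diff of_nat_mult)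
  have "r * real (Suc j) \<le> r * real (2 * q)" using j r(1) by (intro mult_left_mono) auto
  also have "\<dots> \<le> real n - real j" using r j by linarith
  finally have "r * real (Suc j) * real (n choose j) \<le> real (Suc j) * real (n choose Suc j)"
    unfolding eq by (intro mult_right_mono) auto
  then have "real (Suc j) * (r * real (n choose j)) \<le> real (Suc j) * real (n choose Suc j)"
    by (simp only: mult_ac)
  then have "r * real (n choose j) \<le> real (n choose Suc j)"
    by (rule mult_left_le_imp_le) simp
  moreover have "r * (r ^ i * real (n choose (q - 1))) \<le> r * real (n choose j)"
    using Suc r(1) unfolding j_def by (intro mult_left_mono) auto
  ultimately show ?case by (simp add: j_def mult_ac)
qed

lemma exists_power_of_two_between:
  fixes x :: real
  assumes "1 \<le> x"
  shows "\<exists>e. (2::real) ^ e \<le> x \<and> x < 2 * 2 ^ e"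
proof -
  obtain k where k: "x < 2 ^ k" using real_arch_pow[of 2 x] by auto
  define k0 where "k0 = (LEAST k. x < 2 ^ k)"
  have 1: "x < 2 ^ k0" unfolding k0_def by (rule LeastI[of _ k]) (rule k)
  then obtain e where e: "k0 = Suc e" using assms by (cases k0) auto
  then have "\<not> x < 2 ^ e" using not_less_Least[of e "\<lambda>k. x < 2 ^ k"] by (simp add: k0_def)
  with 1 e show ?thesis by (intro exI[of _ e]) auto
qed

text \<open>If \<open>q \<le> c * n\<close>, each of the \<open>q\<close> quotients is at least
  \<open>(1 - 2 * c) / (2 * c)\<close>. As \<open>q\<close> is known only up to a factor two, two
  values of \<open>c\<close> are used, 3/25 and 4/25.\<close>

lemma exponential_binomial_ratio:
  assumes n: "7 \<le> n"
  shows "\<exists>e q. q = (2::nat) ^ e \<and> 2 * q - 1 \<le> n \<and>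
    (1.09::real) ^ n * real (n choose (q - 1)) \<le> real (n choose (2 * q - 1))"
proof -
  \<comment> \<open>\<open>7 \<le> n\<close> makes \<open>4 / 25 * n\<close> at least 1, so that a
    power of two fits below it.\<close>
  obtain e where e: "(2::real) ^ e \<le> 4 / 25 * n" "4 / 25 * real n < 2 * 2 ^ e"
    using exists_power_of_two_between[of "4 / 25 * n"] n by auto
  define q where "q = (2::nat) ^ e"
  have q: "25 * q \<le> 4 * n" "2 * n \<le> 25 * q"
  proof -
    have "real (25 * q) \<le> real (4 * n)" "real (2 * n) \<le> real (25 * q)"
      using e by (auto simp: q_def)
    then show "25 * q \<le> 4 * n" "2 * n \<le> 25 * q" by linarith+
  qed
  have q0: "0 < q" by (simp add: q_def)
  \<comment> \<open>Taking 25th powers turns the bound \<open>t * n / 25 \<le> q\<close> into one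
    between integer exponents.\<close>
  have bound: "(1.09::real) ^ n * real (n choose (q - 1)) \<le> real (n choose (2 * q - 1))"
    if r: "1 \<le> r" "r * real (2 * q) \<le> real n - real (2 * q)"
      and t: "t * n \<le> 25 * q" "(1.09::real) ^ 25 \<le> r ^ t" for r t
  proof -
    have "((1.09::real) ^ n) ^ 25 = (1.09 ^ 25) ^ n" by (simp only: power_mult[symmetric] mult.commute)
    also have "\<dots> \<le> (r ^ t) ^ n" by (intro power_mono t(2)) simp
    also have "\<dots> = r ^ (t * n)" by (simp add: power_mult)
    also have "\<dots> \<le> r ^ (25 * q)" by (intro power_increasing t r)
    also have "\<dots> = (r ^ q) ^ 25" by (simp only: power_mult[symmetric] mult.commute)
    finally have "(1.09::real) ^ n \<le> r ^ q"
      by (rule power_le_imp_le_base[where n = 24, simplified]) (use r in auto)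
    then have "(1.09::real) ^ n * real (n choose (q - 1)) \<le> r ^ q * real (n choose (q - 1))"
      by (intro mult_right_mono) auto
    also have "\<dots> \<le> real (n choose (q - 1 + q))"
      by (rule power_le_binomial_ratio) (use r q0 in auto)
    also have "q - 1 + q = 2 * q - 1" using q0 by simp
    finally show ?thesis .
  qed
  have "(1.09::real) ^ n * real (n choose (q - 1)) \<le> real (n choose (2 * q - 1))"
  \<comment> \<open>Here \<open>c = 3 / 25\<close> gives \<open>r = 19 / 6\<close>, with
    \<open>q \<ge> 2 * n / 25\<close>. In the other case \<open>c = 4 / 25\<close> gives
    \<open>r = 17 / 8\<close>, with \<open>q > 3 * n / 25\<close>.\<close>
  proof (cases "25 * q \<le> 3 * n")
    case True
    then have "25 * real q \<le> 3 * real n" by linarith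
    then show ?thesis using bound[of "19/6" 2] q by (simp add: power_divide)
  next
    case False
    have "25 * real q \<le> 4 * real n" using q by linarith
    then show ?thesis using False bound[of "17/8" 3] q by (simp add: power_divide)
  qed
  then show ?thesis using q by (intro exI[of _ e] exI[of _ q]) (auto simp: q_def)
qed

section \<open>Random subsets\<close>

text \<open>The probability that a random subset of \<open>X\<close>, containing each element
  independently with probability \<open>p\<close>, includes \<open>T\<close> and misses
  \<open>S\<close>. It is the expansion of the product over \<open>X\<close> into a sum over
  subsets.\<close>

lemma sum_power_weights:
  fixes p :: real
  assumes "finite X" "T \<subseteq> X"
  shows "(\<Sum>F\<in>Pow X. if T \<subseteq> F \<and> S \<inter> F = {} then p ^ card F * (1 - p) ^ card (X - F) else 0) =
    (\<Prod>i\<in>X. (if i \<in> S then 0 else p) + (if i \<in> T then 0 else 1 - p))"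
proof -
  have "(\<Prod>i\<in>F. if i \<in> S then 0 else p) * (\<Prod>i\<in>X - F. if i \<in> T then 0 else 1 - p) =
      (if T \<subseteq> F \<and> S \<inter> F = {} then p ^ card F * (1 - p) ^ card (X - F) else 0)"
    if F: "F \<in> Pow X" for F
  proof (cases "T \<subseteq> F \<and> S \<inter> F = {}")
    case True
    then have "(\<Prod>i\<in>F. if i \<in> S then 0 else p) = p ^ card F"
      "(\<Prod>i\<in>X - F. if i \<in> T then 0 else 1 - p) = (1 - p) ^ card (X - F)"
      by (auto intro!: prod.cong simp flip: prod_constant)
    with True show ?thesis by simp
  next
    case False
    have fin: "finite F" "finite (X - F)" using F assms(1) finite_subset by auto
    from False consider i where "i \<in> T" "i \<notin> F" | i where "i \<in> S" "i \<in> F" by blast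
    then show ?thesis
    proof cases
      case 1
      then have "(\<Prod>i\<in>X - F. if i \<in> T then 0 else 1 - p) = 0"
        using assms(2) fin by (intro prod_zero) auto
      with False show ?thesis by (simp only: if_False mult_zero_right)
    next
      case 2
      then have "(\<Prod>i\<in>F. if i \<in> S then 0 else p) = 0"
        using fin by (intro prod_zero) auto
      with False show ?thesis by (simp only: if_False mult_zero_left)
    qed
  qed
  then show ?thesis
    unfolding prod_add[OF assms(1)] by (intro sum.cong) auto
qed

lemma prod_if_const:
  fixes c :: real
  assumes "finite X" "S \<subseteq> X"
  shows "(\<Prod>i\<in>X. if i \<in> S then c else 1) = c ^ card S"
  using assms by (simp add: prod.If_cases Int_absorb1)

text \<open>First moment method: \<open>small\<close> bounds the expectation of the number of missed
  \<open>S i\<close> plus \<open>t\<close> times the number of included \<open>T j\<close>, so some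
  \<open>F\<close> has value below 1.\<close>

lemma exists_hitting_subset:
  fixes p t :: real
  assumes X: "finite X" and p: "0 \<le> p" "p \<le> 1" and I: "finite I" and J: "finite J" and t: "0 \<le> t"
    and S: "\<And>i. i \<in> I \<Longrightarrow> S i \<subseteq> X" and T: "\<And>j. j \<in> J \<Longrightarrow> T j \<subseteq> X"
    and small: "(\<Sum>i\<in>I. (1 - p) ^ card (S i)) + t * (\<Sum>j\<in>J. p ^ card (T j)) < 1"
  shows "\<exists>F\<subseteq>X. (\<forall>i\<in>I. S i \<inter> F \<noteq> {}) \<and> t * real (card {j\<in>J. T j \<subseteq> F}) < 1"
proof -
  define w where "w F = p ^ card F * (1 - p) ^ card (X - F)" for F
  define f where "f F = real (card {i\<in>I. S i \<inter> F = {}}) + t * real (card {j\<in>J. T j \<subseteq> F})" for F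
  have w0: "0 \<le> w F" for F using p by (simp add: w_def)
  have w1: "(\<Sum>F\<in>Pow X. w F) = 1"
    using sum_power_weights[OF X, of "{}" "{}" p] by (simp add: w_def)
  have wS: "(\<Sum>F\<in>Pow X. if S i \<inter> F = {} then w F else 0) = (1 - p) ^ card (S i)" if "i \<in> I" for i
    using sum_power_weights[OF X, of "{}" "S i" p] prod_if_const[OF X S[OF that], of "1 - p"]
    by (simp add: w_def if_distrib[of "\<lambda>x. x + _"] cong: if_cong)
  have wT: "(\<Sum>F\<in>Pow X. if T j \<subseteq> F then w F else 0) = p ^ card (T j)" if "j \<in> J" for j
    using sum_power_weights[OF X T[OF that], of "{}" p] prod_if_const[OF X T[OF that], of p]
    by (simp add: w_def if_distrib[of "\<lambda>x. _ + x"] cong: if_cong)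
  have f: "f F = (\<Sum>i\<in>I. if S i \<inter> F = {} then 1 else 0) + t * (\<Sum>j\<in>J. if T j \<subseteq> F then 1 else 0)" for F
    using I J by (simp add: f_def sum.If_cases Int_def)
  have "(\<Sum>F\<in>Pow X. w F * f F) =
      (\<Sum>F\<in>Pow X. \<Sum>i\<in>I. if S i \<inter> F = {} then w F else 0) +
      t * (\<Sum>F\<in>Pow X. \<Sum>j\<in>J. if T j \<subseteq> F then w F else 0)"
    unfolding f by (simp add: algebra_simps sum_distrib_left sum.distrib if_distrib cong: if_cong)
  also have "\<dots> = (\<Sum>i\<in>I. (1 - p) ^ card (S i)) + t * (\<Sum>j\<in>J. p ^ card (T j))"
    using wS wT by (subst (1 2) sum.swap) simp
  finally have lt: "(\<Sum>F\<in>Pow X. w F * f F) < (\<Sum>F\<in>Pow X. w F)" using small w1 by simp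
  have "\<exists>F\<in>Pow X. f F < 1"
  proof (rule ccontr)
    assume "\<not> ?thesis"
    then have "(\<Sum>F\<in>Pow X. w F * 1) \<le> (\<Sum>F\<in>Pow X. w F * f F)"
      using w0 by (intro sum_mono mult_left_mono) (auto simp: not_less)
    with lt show False by simp
  qed
  then obtain F where F: "F \<subseteq> X" "f F < 1" by auto
  have "0 \<le> t * real (card {j\<in>J. T j \<subseteq> F})" using t by simp
  then have "real (card {i\<in>I. S i \<inter> F = {}}) < 1" "t * real (card {j\<in>J. T j \<subseteq> F}) < 1"
    using F(2) by (auto simp: f_def)
  \<comment> \<open>A natural number below 1 is 0, so no \<open>S i\<close> is missed.\<close>
  moreover from this(1) have "{i\<in>I. S i \<inter> F = {}} = {}" using I by simp
  ultimately show ?thesis using F(1) by blast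
qed

section \<open>Sparse subgraphs of large girth\<close>

definition arcs :: "('a \<Rightarrow> 'a \<Rightarrow> bool) \<Rightarrow> 'a set \<Rightarrow> ('a \<times> 'a) set" where
  "arcs E A = {(u, v). u \<in> A \<and> v \<in> A \<and> E u v}"

text \<open>The unordered counterpart of \<open>arcs\<close>: counting uses ordered pairs, whereas
  random selection must treat both directions of an edge as one event.\<close>

definition edges :: "('a \<Rightarrow> 'a \<Rightarrow> bool) \<Rightarrow> 'a set \<Rightarrow> 'a set set" where
  "edges E A = {{u, v} |u v. u \<in> A \<and> v \<in> A \<and> E u v}"

lemma edges_eq_image_arcs: "edges E A = (\<lambda>(u, v). {u, v}) ` arcs E A"
  by (auto simp: edges_def arcs_def)

lemma finite_arcs: "finite A \<Longrightarrow> finite (arcs E A)"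
  by (rule finite_subset[of _ "A \<times> A"]) (auto simp: arcs_def)

text \<open>The arcs over an edge \<open>e\<close> lie in \<open>e \<times> e\<close>, which has at
  most four elements; this crude factor suffices below.\<close>

lemma card_arcs_le_edges:
  assumes "finite A"
  shows "card (arcs E A) \<le> 4 * card (edges E A)"
proof -
  have fin: "finite (edges E A)" unfolding edges_eq_image_arcs using assms finite_arcs by blast
  have "arcs E A \<subseteq> (\<Union>e\<in>edges E A. e \<times> e)" by (auto simp: arcs_def edges_def)
  moreover have fin2: "finite (e \<times> e)" if "e \<in> edges E A" for e using that by (auto simp: edges_def)
  ultimately have "card (arcs E A) \<le> card (\<Union>e\<in>edges E A. e \<times> e)"
    using fin by (intro card_mono) auto
  also have "\<dots> \<le> (\<Sum>e\<in>edges E A. card (e \<times> e))" using fin by (rule card_UN_le)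
  also have "\<dots> \<le> (\<Sum>e\<in>edges E A. 4)"
  proof (rule sum_mono)
    fix e assume "e \<in> edges E A"
    then obtain u v where "e = {u, v}" by (auto simp: edges_def)
    then have "card e \<le> 2" by (simp add: card_insert_if)
    then have "card e * card e \<le> 2 * 2" by (rule mult_le_mono) fact
    then show "card (e \<times> e) \<le> 4" by (simp add: card_cartesian_product)
  qed
  finally show ?thesis by simp
qed

section \<open>Counting walks and cycles\<close>

definition walks :: "'a set \<Rightarrow> ('a \<Rightarrow> 'a \<Rightarrow> bool) \<Rightarrow> nat \<Rightarrow> 'a list set" where
  "walks V E k = {vs. length vs = k \<and> set vs \<subseteq> V \<and> (\<forall>i. Suc i < k \<longrightarrow> E (vs ! i) (vs ! Suc i))}"

lemma finite_walks: "finite V \<Longrightarrow> finite (walks V E k)"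
  by (rule finite_subset[OF _ finite_lists_length_eq[of V k]]) (auto simp: walks_def)

text \<open>A walk is extended at its front, with at most \<open>D\<close> choices for each new
  vertex.\<close>

lemma card_walks_le:
  assumes V: "finite V" and deg: "\<And>v. v \<in> V \<Longrightarrow> card {u\<in>V. E u v} \<le> D"
  shows "card (walks V E (Suc k)) \<le> card V * D ^ k"
proof (induction k)
  case 0
  have "walks V E (Suc 0) \<subseteq> (\<lambda>v. [v]) ` V"
    by (auto simp: walks_def length_Suc_conv)
  then show ?case using V surj_card_le by fastforce
next
  case (Suc k)
  have "walks V E (Suc (Suc k)) \<subseteq>
      (\<Union>ws\<in>walks V E (Suc k). (\<lambda>u. u # ws) ` {u\<in>V. E u (hd ws)})"
  proof
    fix vs assume vs: "vs \<in> walks V E (Suc (Suc k))"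
    then obtain u ws where uw: "vs = u # ws" by (auto simp: walks_def length_Suc_conv)
    have E: "E (vs ! i) (vs ! Suc i)" if "Suc i < Suc (Suc k)" for i using vs that by (auto simp: walks_def)
    have "ws \<in> walks V E (Suc k)"
      using vs E[of "Suc _"] uw by (auto simp: walks_def)
    moreover have "u \<in> V" "ws \<noteq> []" using vs uw by (auto simp: walks_def)
    moreover have "E u (hd ws)" using E[of 0] uw \<open>ws \<noteq> []\<close> by (simp add: hd_conv_nth)
    ultimately show "vs \<in> (\<Union>ws\<in>walks V E (Suc k). (\<lambda>u. u # ws) ` {u\<in>V. E u (hd ws)})"
      using uw by blast
  qed
  then have "card (walks V E (Suc (Suc k))) \<le>
      card (\<Union>ws\<in>walks V E (Suc k). (\<lambda>u. u # ws) ` {u\<in>V. E u (hd ws)})"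
    using V finite_walks[OF V] by (intro card_mono) auto
  also have "\<dots> \<le> (\<Sum>ws\<in>walks V E (Suc k). card ((\<lambda>u. u # ws) ` {u\<in>V. E u (hd ws)}))"
    using finite_walks[OF V] by (rule card_UN_le)
  also have "\<dots> \<le> (\<Sum>ws\<in>walks V E (Suc k). D)"
  proof (rule sum_mono)
    fix ws assume "ws \<in> walks V E (Suc k)"
    then have "hd ws \<in> V" by (cases ws) (auto simp: walks_def)
    then show "card ((\<lambda>u. u # ws) ` {u\<in>V. E u (hd ws)}) \<le> D"
      using deg by (simp add: card_image inj_on_def)
  qed
  also have "\<dots> \<le> card V * D ^ k * D" using Suc by simp
  finally show ?case by (simp add: mult_ac)
qed

text \<open>Lists record a start and a direction, so a cycle is counted several times; this is
  harmless for upper bounds.\<close>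

definition cycles :: "'a set \<Rightarrow> ('a \<Rightarrow> 'a \<Rightarrow> bool) \<Rightarrow> nat \<Rightarrow> 'a list set" where
  "cycles V E k = {vs. length vs = k \<and> distinct vs \<and> set vs \<subseteq> V \<and>
     (\<forall>i<k. E (vs ! i) (vs ! ((i + 1) mod k)))}"

definition cycle_edges :: "'a list \<Rightarrow> 'a set set" where
  "cycle_edges vs = (\<lambda>i. {vs ! i, vs ! ((i + 1) mod length vs)}) ` {..<length vs}"

lemma cycles_subset_walks: "cycles V E k \<subseteq> walks V E k"
  unfolding cycles_def walks_def by (auto dest: Suc_lessD)

text \<open>Two positions with the same edge would be cyclic successors of each other, which is
  impossible from length 3 on. Hence a cycle of length \<open>k\<close> survives with probability
  exactly \<open>p ^ k\<close>.\<close>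

lemma card_cycle_edges:
  assumes "distinct vs" "3 \<le> length vs"
  shows "card (cycle_edges vs) = length vs"
proof -
  define k where "k = length vs"
  have "inj_on (\<lambda>i. {vs ! i, vs ! ((i + 1) mod k)}) {..<k}"
  proof (rule inj_onI)
    fix i j assume ij: "i \<in> {..<k}" "j \<in> {..<k}"
      and eq: "{vs ! i, vs ! ((i + 1) mod k)} = {vs ! j, vs ! ((j + 1) mod k)}"
    have k: "3 \<le> k" using assms by (simp add: k_def)
    have "(i + 1) mod k < k" "(j + 1) mod k < k" using k by auto
    then have "i = j \<or> i = (j + 1) mod k \<and> (i + 1) mod k = j"
      using eq ij assms(1) by (auto simp: doubleton_eq_iff nth_eq_iff_index_eq k_def)
    moreover have "(i + 1) mod k = (if i + 1 = k then 0 else i + 1)"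
      "(j + 1) mod k = (if j + 1 = k then 0 else j + 1)" using ij by auto
    ultimately show "i = j" using k by (auto split: if_splits)
  qed
  then show ?thesis unfolding cycle_edges_def k_def by (simp add: card_image)
qed

text \<open>The deletion method: keep each edge with probability \<open>p\<close>, require every set
  of size at least \<open>s\<close> to retain an edge, and remove a vertex from each surviving short
  cycle.\<close>

lemma exists_sparse_subgraph:
  fixes p s :: real and E :: "'a \<Rightarrow> 'a \<Rightarrow> bool"
  assumes V: "finite V" "V \<noteq> {}" and sym: "\<And>u v. E u v \<Longrightarrow> E v u"
    and p: "0 \<le> p" "p \<le> 1"
    and deg: "\<And>v. v \<in> V \<Longrightarrow> card {u\<in>V. E u v} \<le> D"
    and dense: "\<And>A. A \<subseteq> V \<Longrightarrow> s \<le> real (card A) \<Longrightarrow> 8 * real (card V) \<le> p * real (card (arcs E A))"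
    and short: "8 * (\<Sum>k=3..<g. real D ^ (k - 1) * p ^ k) \<le> 1"
  obtains U E' where "U \<subseteq> V" "card V < 2 * card U"
    "\<And>u v. E' u v \<Longrightarrow> u \<in> U \<and> v \<in> U \<and> E u v" "\<And>u v. E' u v \<Longrightarrow> E' v u"
    "girth_at_least U E' g"
    "\<And>A. A \<subseteq> U \<Longrightarrow> s \<le> real (card A) \<Longrightarrow> \<exists>u\<in>A. \<exists>v\<in>A. E' u v"
proof -
  define n where "n = card V"
  have n: "0 < n" using V by (simp add: n_def card_gt_0_iff)
  define I where "I = {A. A \<subseteq> V \<and> s \<le> real (card A)}"
  define J where "J = (\<Union>k\<in>{3..<g}. cycles V E k)"
  have finX: "finite (edges E V)" unfolding edges_eq_image_arcs using V finite_arcs by blast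
  have finI: "finite I" unfolding I_def using V by simp
  have finc: "finite (cycles V E k)" for k
    using finite_subset[OF cycles_subset_walks] finite_walks[OF V(1)] by blast
  have finJ: "finite J" unfolding J_def using finc by blast
  have J_edges: "cycle_edges vs \<subseteq> edges E V" if vs: "vs \<in> J" for vs
  proof -
    obtain k where k: "3 \<le> k" "vs \<in> cycles V E k" using vs by (auto simp: J_def)
    have "{vs ! i, vs ! ((i + 1) mod length vs)} \<in> edges E V" if i: "i < length vs" for i
    proof -
      have "(i + 1) mod length vs < length vs" using i by (intro mod_less_divisor) auto
      then have "vs ! ((i + 1) mod length vs) \<in> V" "vs ! i \<in> V"
        using i k(2) nth_mem unfolding cycles_def by blast+
      moreover have "E (vs ! i) (vs ! ((i + 1) mod length vs))"
        using i k(2) by (auto simp: cycles_def)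
      ultimately show ?thesis unfolding edges_def by blast
    qed
    then show ?thesis by (auto simp: cycle_edges_def)
  qed
  have I_edges: "edges E A \<subseteq> edges E V" if "A \<in> I" for A
    using that by (auto simp: I_def edges_def)
  \<comment> \<open>Union bound: \<open>dense\<close> and the factor 4 between arcs and edges make
    each set fail with probability at most \<open>exp (- 2 * n)\<close>, below
    \<open>(1 / 4) ^ n\<close>, and there are at most \<open>2 ^ n\<close> sets.\<close>
  have sumI: "(\<Sum>A\<in>I. (1 - p) ^ card (edges E A)) \<le> 1 / 2"
  proof -
    have "(1 - p) ^ card (edges E A) \<le> (1 / 4) ^ n" if A: "A \<in> I" for A
    proof -
      have "finite A" using A V finite_subset by (auto simp: I_def)
      then have "real (card (arcs E A)) \<le> 4 * real (card (edges E A))"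
        using card_arcs_le_edges[of A E] by linarith
      then have "p * real (card (arcs E A)) \<le> p * (4 * real (card (edges E A)))"
        using p by (intro mult_left_mono)
      with dense[of A] A have c: "2 * real n \<le> p * real (card (edges E A))"
        by (simp add: I_def n_def)
      have "(1 - p) ^ card (edges E A) \<le> exp (- p) ^ card (edges E A)"
        using p exp_ge_add_one_self[of "- p"] by (intro power_mono) auto
      also have "\<dots> = exp (- (p * real (card (edges E A))))"
        by (simp add: mult.commute flip: exp_of_nat_mult)
      also have "\<dots> \<le> exp (- (2 * real n))" using c by simp
      also have "\<dots> = (exp (- 1) * exp (-1)) ^ n"
        by (simp add: mult.commute flip: exp_of_nat_mult exp_add)
      also have "\<dots> \<le> (1 / 4) ^ n"
      proof (rule power_mono)
        have e: "exp (- 1) \<le> (1 / 2 :: real)"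
          using exp_ge_add_one_self[of 1] by (simp add: exp_minus field_simps)
        have "exp (- 1) * exp (- 1) \<le> (1 / 2) * (1 / 2 :: real)" by (rule mult_mono[OF e e]) auto
        then show "exp (- 1) * exp (- 1) \<le> (1 / 4 :: real)" by simp
      qed simp
      finally show ?thesis .
    qed
    then have "(\<Sum>A\<in>I. (1 - p) ^ card (edges E A)) \<le> real (card I) * (1 / 4) ^ n"
      by (rule sum_bounded_above)
    also have "\<dots> \<le> real (card (Pow V)) * (1 / 4) ^ n"
      using V by (intro mult_right_mono) (auto simp: I_def intro!: card_mono)
    also have "\<dots> = (1 / 2) ^ n"
      using V by (simp add: card_Pow n_def power_mult_distrib[symmetric])
    also have "\<dots> \<le> (1 / 2) ^ 1" using n by (intro power_decreasing) auto
    finally show ?thesis by simp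
  qed
  have sumJ: "(\<Sum>vs\<in>J. p ^ card (cycle_edges vs)) \<le> real n / 8"
  proof -
    have "(\<Sum>vs\<in>J. p ^ card (cycle_edges vs)) \<le> (\<Sum>k=3..<g. \<Sum>vs\<in>cycles V E k. p ^ card (cycle_edges vs))"
      unfolding J_def using finc
      by (intro eq_refl sum.UNION_disjoint) (auto simp: cycles_def)
    also have "\<dots> \<le> (\<Sum>k=3..<g. real n * (real D ^ (k - 1) * p ^ k))"
    proof (rule sum_mono)
      fix k assume k: "k \<in> {3..<g}"
      have "(\<Sum>vs\<in>cycles V E k. p ^ card (cycle_edges vs)) = (\<Sum>vs\<in>cycles V E k. p ^ k)"
        using k by (intro sum.cong) (auto simp: cycles_def card_cycle_edges)
      also have "\<dots> = real (card (cycles V E k)) * p ^ k" by simp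
      also have "\<dots> \<le> real (n * D ^ (k - 1)) * p ^ k"
      proof (intro mult_right_mono of_nat_mono)
        have "card (cycles V E k) \<le> card (walks V E k)"
          using finite_walks[OF V(1)] by (intro card_mono cycles_subset_walks)
        also have "\<dots> \<le> n * D ^ (k - 1)"
          using card_walks_le[OF V(1) deg, where k = "k - 1"] k by (simp add: n_def)
        finally show "card (cycles V E k) \<le> n * D ^ (k - 1)" .
      qed (use p in simp)
      finally show "(\<Sum>vs\<in>cycles V E k. p ^ card (cycle_edges vs)) \<le> real n * (real D ^ (k - 1) * p ^ k)"
        by (simp add: mult.assoc)
    qed
    also have "\<dots> = real n * (\<Sum>k=3..<g. real D ^ (k - 1) * p ^ k)" by (simp add: sum_distrib_left)
    also have "\<dots> \<le> real n * (1 / 8)" using short by (intro mult_left_mono) auto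
    finally show ?thesis by simp
  qed
  \<comment> \<open>The weight \<open>2 / n\<close> makes the conclusion say that fewer than
    \<open>n / 2\<close> short cycles survive; the two contributions are at most 1/2 and
    1/4.\<close>
  have "2 / real n * (\<Sum>vs\<in>J. p ^ card (cycle_edges vs)) \<le> 2 / real n * (real n / 8)"
    using sumJ by (rule mult_left_mono) simp
  also have "\<dots> = 1 / 4" using n by simp
  finally have "(\<Sum>A\<in>I. (1 - p) ^ card (edges E A)) + 2 / real n * (\<Sum>vs\<in>J. p ^ card (cycle_edges vs)) < 1"
    using sumI by linarith
  then obtain F where F: "F \<subseteq> edges E V" "\<forall>A\<in>I. edges E A \<inter> F \<noteq> {}"
    and few: "2 / real n * real (card {vs\<in>J. cycle_edges vs \<subseteq> F}) < 1"
    using exists_hitting_subset[OF finX p finI finJ, of "2 / real n" "edges E" cycle_edges]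
      J_edges I_edges by auto
  define B where "B = {vs\<in>J. cycle_edges vs \<subseteq> F}"
  define U where "U = V - hd ` B"
  define E' where "E' u v \<longleftrightarrow> u \<in> U \<and> v \<in> U \<and> E u v \<and> {u, v} \<in> F" for u v
  have "2 * card B < n" using few n by (simp add: B_def field_simps)
  moreover have "n - card (hd ` B) \<le> card U" unfolding U_def n_def using finJ
    by (intro diff_card_le_card_Diff) (simp add: B_def)
  moreover have "card (hd ` B) \<le> card B" using finJ by (intro card_image_le) (simp add: B_def)
  ultimately have cU: "card V < 2 * card U" by (simp add: n_def)
  have girth: "girth_at_least U E' g"
    unfolding girth_at_least_def has_cycle_of_length_def
  proof (intro allI impI notI, elim conjE exE)
    fix k vs assume k: "k < g" "3 \<le> k" and vs: "length vs = k" "distinct vs" "set vs \<subseteq> U"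
      "\<forall>i<k. E' (vs ! i) (vs ! ((i + 1) mod k))"
    \<comment> \<open>A short cycle of \<open>E'\<close> would be a surviving cycle, whose first
      vertex is not in \<open>U\<close>.\<close>
    have "vs \<in> cycles V E k" using vs by (auto simp: cycles_def U_def E'_def)
    then have "vs \<in> J" using k by (auto simp: J_def)
    moreover have "cycle_edges vs \<subseteq> F" using vs by (auto simp: cycle_edges_def E'_def)
    ultimately have "hd vs \<in> hd ` B" by (auto simp: B_def)
    moreover have "hd vs \<in> U" using vs k by (cases vs) auto
    ultimately show False by (simp add: U_def)
  qed
  have hit: "\<exists>u\<in>A. \<exists>v\<in>A. E' u v" if A: "A \<subseteq> U" "s \<le> real (card A)" for A
  proof -
    have "A \<in> I" using A by (auto simp: I_def U_def)
    then obtain u v where "u \<in> A" "v \<in> A" "E u v" "{u, v} \<in> F"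
      using F(2) by (fastforce simp: edges_def)
    then show ?thesis using A unfolding E'_def by blast
  qed
  show thesis
    by (rule that[of U E'])
      (use cU girth hit in \<open>auto simp: E'_def U_def sym insert_commute\<close>)
qed

section \<open>Cartesian powers\<close>

text \<open>Removing the first vertex of every arc leaves an independent set, of size at most
  \<open>a\<close>.\<close>

lemma card_le_independence_plus_arcs:
  assumes "finite A" and "\<And>B. B \<subseteq> A \<Longrightarrow> a < card B \<Longrightarrow> \<exists>u\<in>B. \<exists>v\<in>B. E u v"
  shows "card A \<le> a + card (arcs E A)"
proof -
  define B where "B = A - fst ` arcs E A"
  have "\<not> (\<exists>u\<in>B. \<exists>v\<in>B. E u v)" by (force simp: B_def arcs_def)
  then have "card B \<le> a" using assms(2)[of B] by (metis B_def Diff_subset not_less)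
  moreover have "card A - card (fst ` arcs E A) \<le> card B"
    unfolding B_def using assms(1) finite_arcs by (intro diff_card_le_card_Diff) blast
  moreover have "card (fst ` arcs E A) \<le> card (arcs E A)"
    using assms(1) by (intro card_image_le finite_arcs)
  ultimately show ?thesis by linarith
qed

text \<open>Adjacency of the Cartesian power of a graph, by recursion on the coordinates; the zeroth
  power is a single vertex without edges.\<close>

fun cart_adj :: "('a \<Rightarrow> 'a \<Rightarrow> bool) \<Rightarrow> 'a list \<Rightarrow> 'a list \<Rightarrow> bool" where
  "cart_adj E (x # xs) (y # ys) \<longleftrightarrow> x = y \<and> cart_adj E xs ys \<or> xs = ys \<and> E x y"
| "cart_adj E _ _ \<longleftrightarrow> False"

lemma cart_adj_sym:
  assumes "\<And>u v. E u v \<Longrightarrow> E v u" "cart_adj E xs ys"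
  shows "cart_adj E ys xs"
  using assms by (induction E xs ys rule: cart_adj.induct) auto

lemma cart_adj_irrefl:
  assumes "\<And>u. \<not> E u u"
  shows "\<not> cart_adj E xs xs"
  by (induction xs) (auto simp: assms)

definition cart_pow :: "'a set \<Rightarrow> nat \<Rightarrow> 'a list set" where
  "cart_pow W m = {xs. set xs \<subseteq> W \<and> length xs = m}"

lemma finite_cart_pow: "finite W \<Longrightarrow> finite (cart_pow W m)"
  by (simp add: cart_pow_def finite_lists_length_eq)

lemma card_cart_pow: "finite W \<Longrightarrow> card (cart_pow W m) = card W ^ m"
  by (simp add: cart_pow_def card_lists_length_eq)

lemma Cons_in_cart_pow: "x # xs \<in> cart_pow W (Suc m) \<longleftrightarrow> x \<in> W \<and> xs \<in> cart_pow W m"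
  by (auto simp: cart_pow_def)

lemma cart_pow_SucE:
  assumes "ys \<in> cart_pow W (Suc m)"
  obtains x xs where "ys = x # xs" "x \<in> W" "xs \<in> cart_pow W m"
  using assms by (cases ys) (auto simp: cart_pow_def)

lemma card_cart_adj_le:
  assumes W: "finite W" and "xs \<in> cart_pow W m"
  shows "card {ys\<in>cart_pow W m. cart_adj E ys xs} \<le> m * card W"
  using assms(2)
proof (induction m arbitrary: xs)
  case 0
  then show ?case by (simp add: cart_pow_def)
next
  case (Suc m)
  then obtain x zs where x: "xs = x # zs" "x \<in> W" "zs \<in> cart_pow W m" by (elim cart_pow_SucE)
  have "{ys\<in>cart_pow W (Suc m). cart_adj E ys xs} \<subseteq>
      (#) x ` {ys\<in>cart_pow W m. cart_adj E ys zs} \<union> (\<lambda>y. y # zs) ` W"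
    by (auto elim!: cart_pow_SucE simp: x)
  then have "card {ys\<in>cart_pow W (Suc m). cart_adj E ys xs} \<le>
      card ((#) x ` {ys\<in>cart_pow W m. cart_adj E ys zs} \<union> (\<lambda>y. y # zs) ` W)"
    using W finite_cart_pow[OF W, of m] by (intro card_mono) auto
  also have "\<dots> \<le> card ((#) x ` {ys\<in>cart_pow W m. cart_adj E ys zs}) + card ((\<lambda>y. y # zs) ` W)"
    by (rule card_Un_le)
  also have "\<dots> \<le> m * card W + card W"
    using Suc.IH[OF x(3)] by (intro add_mono) (auto simp: card_image inj_on_def)
  finally show ?case by simp
qed

text \<open>In each of the \<open>m\<close> directions \<open>A\<close> meets the lines in
  \<open>card A\<close> points altogether, and each of the \<open>card W ^ (m - 1)\<close> lines
  yields an arc for all but \<open>a\<close> of them. The factor \<open>card W\<close> and the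
  additive form avoid subtraction and the exponent \<open>m - 1\<close>.\<close>

lemma card_arcs_cart_pow:
  assumes W: "finite W" and irr: "\<And>u. \<not> E u u"
    and a: "\<And>B. B \<subseteq> W \<Longrightarrow> a < card B \<Longrightarrow> \<exists>u\<in>B. \<exists>v\<in>B. E u v"
    and "A \<subseteq> cart_pow W m"
  shows "card W * m * card A \<le> card W * card (arcs (cart_adj E) A) + m * a * card W ^ m"
  using assms(4)
proof (induction m arbitrary: A)
  case 0
  then show ?case by simp
next
  case (Suc m)
  let ?N = "card W"
  define L where "L = cart_pow W m"
  define H where "H x = {xs. x # xs \<in> A}" for x
  define K where "K xs = {x. x # xs \<in> A}" for xs
  have HL: "H x \<subseteq> L" for x using Suc.prems by (auto simp: H_def L_def Cons_in_cart_pow)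
  have KW: "K xs \<subseteq> W" for xs using Suc.prems by (auto simp: K_def Cons_in_cart_pow)
  have finL: "finite L" unfolding L_def by (rule finite_cart_pow[OF W])
  have finH: "finite (H x)" for x using HL finL finite_subset by blast
  have finK: "finite (K xs)" for xs using KW W finite_subset by blast
  have finA: "finite A" using Suc.prems finite_cart_pow[OF W] finite_subset by blast
  have cardL: "card L = ?N ^ m" unfolding L_def by (rule card_cart_pow[OF W])
  have Cons_A: "\<exists>x\<in>W. \<exists>xs\<in>L. ys = x # xs \<and> x # xs \<in> A" if "ys \<in> A" for ys
    using that Suc.prems unfolding L_def by (metis cart_pow_SucE subsetD)
  have "A = (\<lambda>(x, xs). x # xs) ` (SIGMA x:W. H x)"
    using Cons_A by (fastforce simp: H_def)
  moreover have "card ((\<lambda>(x, xs). x # xs) ` (SIGMA x:W. H x)) = (\<Sum>x\<in>W. card (H x))"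
    by (subst card_image) (use W finH in \<open>auto simp: inj_on_def\<close>)
  ultimately have cH: "card A = (\<Sum>x\<in>W. card (H x))" by simp
  have "A = (\<lambda>(xs, x). x # xs) ` (SIGMA xs:L. K xs)"
    using Cons_A by (fastforce simp: K_def)
  moreover have "card ((\<lambda>(xs, x). x # xs) ` (SIGMA xs:L. K xs)) = (\<Sum>xs\<in>L. card (K xs))"
    by (subst card_image) (use finL finK in \<open>auto simp: inj_on_def\<close>)
  ultimately have cK: "card A = (\<Sum>xs\<in>L. card (K xs))" by simp
  \<comment> \<open>\<open>P\<close> holds arcs that fix the first coordinate, \<open>Q\<close>
    those that move it; irreflexivity makes them disjoint.\<close>
  define P where "P = (\<lambda>(x, xs, ys). (x # xs, x # ys)) ` (SIGMA x:W. arcs (cart_adj E) (H x))"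
  define Q where "Q = (\<lambda>(xs, x, y). (x # xs, y # xs)) ` (SIGMA xs:L. arcs E (K xs))"
  have "card P = (\<Sum>x\<in>W. card (arcs (cart_adj E) (H x)))"
    unfolding P_def by (subst card_image) (use W in \<open>auto simp: inj_on_def finite_arcs[OF finH]\<close>)
  moreover have "card Q = (\<Sum>xs\<in>L. card (arcs E (K xs)))"
    unfolding Q_def by (subst card_image) (use finL in \<open>auto simp: inj_on_def finite_arcs[OF finK]\<close>)
  moreover have "P \<inter> Q = {}" using irr cart_adj_irrefl[of E] by (auto simp: P_def Q_def arcs_def)
  moreover have "P \<union> Q \<subseteq> arcs (cart_adj E) A" by (auto simp: P_def Q_def arcs_def H_def K_def)
  moreover have "finite P" "finite Q"
    unfolding P_def Q_def using W finL finH finK finite_arcs by blast+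
  ultimately have arcs: "(\<Sum>x\<in>W. card (arcs (cart_adj E) (H x))) + (\<Sum>xs\<in>L. card (arcs E (K xs)))
      \<le> card (arcs (cart_adj E) A)"
    using card_mono[OF finite_arcs[OF finA], of "P \<union> Q" "cart_adj E"] by (simp add: card_Un_disjoint)
  \<comment> \<open>Directions other than the first: the induction hypothesis in every layer
    \<open>H x\<close>.\<close>
  have "(\<Sum>x\<in>W. ?N * m * card (H x)) \<le> (\<Sum>x\<in>W. ?N * card (arcs (cart_adj E) (H x)) + m * a * ?N ^ m)"
    using Suc.IH HL unfolding L_def by (intro sum_mono) blast
  then have 1: "?N * m * card A \<le> ?N * (\<Sum>x\<in>W. card (arcs (cart_adj E) (H x))) + m * a * ?N ^ Suc m"
    unfolding cH by (simp add: sum.distrib sum_distrib_left mult_ac)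
  \<comment> \<open>The first direction: every line \<open>K xs\<close> is a subset of the base
    graph.\<close>
  have "(\<Sum>xs\<in>L. card (K xs)) \<le> (\<Sum>xs\<in>L. a + card (arcs E (K xs)))"
    using KW by (intro sum_mono card_le_independence_plus_arcs finK a) auto
  then have "card A \<le> (\<Sum>xs\<in>L. card (arcs E (K xs))) + a * ?N ^ m"
    unfolding cK by (simp add: sum.distrib cardL mult_ac)
  then have 2: "?N * card A \<le> ?N * ((\<Sum>xs\<in>L. card (arcs E (K xs))) + a * ?N ^ m)"
    by (rule mult_le_mono2)
  have 3: "?N * ((\<Sum>x\<in>W. card (arcs (cart_adj E) (H x))) + (\<Sum>xs\<in>L. card (arcs E (K xs))))
      \<le> ?N * card (arcs (cart_adj E) A)" using arcs by (rule mult_le_mono2)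
  show ?case using 1 2 3 by (simp add: algebra_simps)
qed

section \<open>Embedding Cartesian powers\<close>

fun position :: "('a \<Rightarrow> nat \<Rightarrow> complex) \<Rightarrow> complex list \<Rightarrow> 'a list \<Rightarrow> nat \<Rightarrow> complex" where
  "position z (c # cs) (x # xs) = (\<lambda>j. c * z x j + position z cs xs j)"
| "position z _ _ = (\<lambda>j. 0)"

lemma position_eq_0:
  assumes "\<And>x. x \<in> W \<Longrightarrow> z x j = 0" "set xs \<subseteq> W"
  shows "position z cs xs j = 0"
  using assms by (induction z cs xs rule: position.induct) auto

text \<open>Only one summand differs, and its factor of modulus one preserves length.\<close>

lemma position_adjacent_dist:
  assumes "\<And>x y. x \<in> W \<Longrightarrow> y \<in> W \<Longrightarrow> E x y \<Longrightarrow> (\<Sum>j<k. (cmod (z x j - z y j))\<^sup>2) = r"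
    and "\<forall>c\<in>set cs. cmod c = 1" "cart_adj E xs ys" "length cs = length xs" "set xs \<subseteq> W" "set ys \<subseteq> W"
  shows "(\<Sum>j<k. (cmod (position z cs xs j - position z cs ys j))\<^sup>2) = r"
  using assms(2-)
proof (induction cs arbitrary: xs ys)
  case Nil
  then show ?case by simp
next
  case (Cons c cs)
  then obtain x xs' y ys' where eq: "xs = x # xs'" "ys = y # ys'"
    by (cases xs; cases ys) auto
  show ?case
  proof (cases "x = y \<and> cart_adj E xs' ys'")
    case True
    then show ?thesis using Cons eq by simp
  next
    case False
    then have "xs' = ys'" "E x y" using Cons.prems eq by auto
    moreover have "cmod (c * z x j - c * z y j) = cmod (z x j - z y j)" for j
      using Cons.prems(1) by (simp flip: right_diff_distrib add: norm_mult)
    ultimately show ?thesis using Cons.prems eq assms(1)[of x y] by simp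
  qed
qed

text \<open>An arc of the circle is parametrised injectively by its real part.\<close>

lemma infinite_unit_circle: "infinite {c. cmod c = 1}"
proof -
  have "inj_on (\<lambda>t. Complex t (sqrt (1 - t\<^sup>2))) {0..1}" by (auto simp: inj_on_def)
  moreover have "infinite {0..1::real}" by (simp add: infinite_Icc)
  ultimately have "infinite ((\<lambda>t. Complex t (sqrt (1 - t\<^sup>2))) ` {0..1})"
    using finite_imageD by blast
  moreover have "(\<lambda>t. Complex t (sqrt (1 - t\<^sup>2))) ` {0..1} \<subseteq> {c. cmod c = 1}"
    by (auto simp: cmod_def abs_square_le_1)
  ultimately show ?thesis using finite_subset by blast
qed

text \<open>
  Each coincidence between two positions determines the last factor \<open>c\<close> uniquely, so only
  finitely many rotations have to be avoided.
\<close>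
lemma exists_injective_position:
  assumes W: "finite W" and inj: "inj_on z W" and supp: "\<And>x j. x \<in> W \<Longrightarrow> k \<le> j \<Longrightarrow> z x j = 0"
  shows "\<exists>cs. length cs = m \<and> (\<forall>c\<in>set cs. cmod c = 1) \<and> inj_on (position z cs) (cart_pow W m)"
proof (induction m)
  case 0
  then show ?case by (auto simp: cart_pow_def inj_on_def)
next
  case (Suc m)
  then obtain cs where cs: "length cs = m" "\<forall>c\<in>set cs. cmod c = 1"
    and inj': "inj_on (position z cs) (cart_pow W m)" by blast
  \<comment> \<open>The quotient solves the coincidence in coordinate \<open>j\<close> for the new
    factor. A zero denominator merely contributes the default value 0.\<close>
  define bad where "bad = (\<lambda>(j, x, y, xs, ys).
    (position z cs ys j - position z cs xs j) / (z x j - z y j)) `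
      ({..<k} \<times> W \<times> W \<times> cart_pow W m \<times> cart_pow W m)"
  have "finite bad" unfolding bad_def using W finite_cart_pow[OF W] by blast
  then obtain c where c: "cmod c = 1" "c \<notin> bad"
    using infinite_unit_circle by (metis (mono_tags) finite_subset mem_Collect_eq subsetI)
  have "inj_on (position z (c # cs)) (cart_pow W (Suc m))"
  proof (rule inj_onI)
    fix us vs assume "us \<in> cart_pow W (Suc m)" "vs \<in> cart_pow W (Suc m)"
      and eq: "position z (c # cs) us = position z (c # cs) vs"
    then obtain x xs y ys where us: "us = x # xs" "x \<in> W" "xs \<in> cart_pow W m"
      and vs: "vs = y # ys" "y \<in> W" "ys \<in> cart_pow W m" by (elim cart_pow_SucE)
    have eqj: "c * z x j + position z cs xs j = c * z y j + position z cs ys j" for j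
      using fun_cong[OF eq, of j] us vs by simp
    have "x = y"
    proof (rule ccontr)
      assume "x \<noteq> y"
      then obtain j where j: "z x j \<noteq> z y j" using inj us(2) vs(2) by (meson ext inj_onD)
      \<comment> \<open>The bounded support leaves finitely many coordinates \<open>j\<close>, hence
        finitely many bad factors.\<close>
      then have "j < k" using supp us(2) vs(2) by (metis not_less)
      moreover have "c = (position z cs ys j - position z cs xs j) / (z x j - z y j)"
        using eqj[of j] j by (simp add: field_simps)
      ultimately have "c \<in> bad" unfolding bad_def using us vs by (auto simp: image_iff) blast
      with c show False by simp
    qed
    then have "position z cs xs = position z cs ys" using eqj by (auto simp: fun_eq_iff)
    with \<open>x = y\<close> show "us = vs" using inj' us vs by (auto dest: inj_onD)
  qed
  with c cs show ?case by (intro exI[of _ "c # cs"]) auto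
qed

section \<open>From complex coordinates to twice as many real ones\<close>

definition realify :: "(nat \<Rightarrow> complex) \<Rightarrow> nat \<Rightarrow> real" where
  "realify x i = (if even i then Re (x (i div 2)) else Im (x (i div 2)))"

lemma inj_realify: "inj realify"
proof (rule injI)
  fix x y :: "nat \<Rightarrow> complex" assume eq: "realify x = realify y"
  show "x = y"
  proof
    fix j show "x j = y j"
      using fun_cong[OF eq, of "2 * j"] fun_cong[OF eq, of "2 * j + 1"]
      by (simp add: realify_def complex_eq_iff)
  qed
qed

lemma sum_realify: "(\<Sum>i<2 * k. (realify x i - realify y i)\<^sup>2) = (\<Sum>j<k. (cmod (x j - y j))\<^sup>2)"
  by (induction k) (auto simp: realify_def cmod_power2)

text \<open>All coordinates from \<open>2 * k\<close> on vanish, so a spare dimension, as for odd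
  \<open>d\<close>, leaves the distance unchanged.\<close>

lemma dist_realify:
  assumes "\<And>j. k \<le> j \<Longrightarrow> x j = 0" "\<And>j. k \<le> j \<Longrightarrow> y j = 0" "2 * k \<le> d"
  shows "dist_Rd d (realify x) (realify y) = sqrt (\<Sum>j<k. (cmod (x j - y j))\<^sup>2)"
proof -
  have "(\<Sum>i<d. (realify x i - realify y i)\<^sup>2) = (\<Sum>i<2 * k. (realify x i - realify y i)\<^sup>2)"
    using assms by (intro sum.mono_neutral_right) (auto simp: realify_def)
  then show ?thesis by (simp add: dist_Rd_def sum_realify)
qed

section \<open>Unit distance graphs of large girth\<close>

text \<open>Giving all vertices different colours is a colouring, so the \<open>LEAST\<close> is
  attained.\<close>

lemma colorable_chromatic_number:
  assumes "finite V" and "\<And>v. \<not> E v v"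
  shows "colorable V E (chromatic_number V E)"
proof -
  obtain f where f: "bij_betw f V {0..<card V}" using ex_bij_betw_finite_nat[OF assms(1)] by blast
  have "colorable V E (card V)"
    unfolding colorable_def
  proof (intro exI[of _ f] conjI ballI impI)
    show "f v < card V" if "v \<in> V" for v using f that by (auto simp: bij_betw_def)
    show "f u \<noteq> f v" if "u \<in> V" "v \<in> V" "E u v" for u v
      using that f assms(2) by (metis bij_betw_def inj_onD)
  qed
  then show ?thesis unfolding chromatic_number_def by (rule LeastI)
qed

text \<open>A colour class spans no edge, so its size is below \<open>s\<close>.\<close>

lemma card_le_colors_mult_independence:
  fixes s :: real
  assumes "colorable U E K"
    and indep: "\<And>A. A \<subseteq> U \<Longrightarrow> s \<le> real (card A) \<Longrightarrow> \<exists>u\<in>A. \<exists>v\<in>A. E u v"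
  shows "real (card U) \<le> real K * s"
proof -
  obtain c :: "'a \<Rightarrow> nat" where c: "\<And>v. v \<in> U \<Longrightarrow> c v < K"
    "\<And>u v. u \<in> U \<Longrightarrow> v \<in> U \<Longrightarrow> E u v \<Longrightarrow> c u \<noteq> c v"
    using assms(1) unfolding colorable_def by blast
  have small: "real (card {v\<in>U. c v = i}) \<le> s" for i
  proof (rule ccontr)
    assume "\<not> ?thesis"
    then obtain u v where "u \<in> U" "v \<in> U" "E u v" "c u = i" "c v = i"
      using indep[of "{v\<in>U. c v = i}"] by auto
    then show False using c(2)[of u v] by simp
  qed
  have "(\<Union>i<K. {v\<in>U. c v = i}) = U" using c(1) by auto
  then have "card U \<le> (\<Sum>i<K. card {v\<in>U. c v = i})"
    using card_UN_le[of "{..<K}" "\<lambda>i. {v\<in>U. c v = i}"] by simp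
  then have "real (card U) \<le> (\<Sum>i<K. real (card {v\<in>U. c v = i}))"
    by (simp only: of_nat_sum[symmetric] of_nat_le_iff)
  also have "\<dots> \<le> (\<Sum>i<K. s)" by (intro sum_mono small)
  finally show ?thesis by simp
qed

text \<open>The construction has lists as vertices, the theorem natural numbers. Colourings of the
  copy are pulled back, so lower bounds on the chromatic number carry over.\<close>

lemma transfer_graph_to_nat:
  fixes V :: "'a set"
  assumes simple: "finite_simple_graph V E" and unit: "unit_distance_graph d V E"
    and girth: "girth_at_least V E g"
  obtains V' :: "nat set" and E' where "finite_simple_graph V' E'" "unit_distance_graph d V' E'"
    "girth_at_least V' E' g" "\<And>K. colorable V' E' K \<Longrightarrow> colorable V E K"
proof -
  have "finite V" using simple unfolding finite_simple_graph_def by blast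
  then obtain h where h: "bij_betw h {0..<card V} V" using ex_bij_betw_nat_finite by blast
  define V' where "V' = {0..<card V}"
  define E' where "E' x y \<longleftrightarrow> x \<in> V' \<and> y \<in> V' \<and> E (h x) (h y)" for x y
  have hV: "h x \<in> V" if "x \<in> V'" for x using h that by (auto simp: V'_def bij_betw_def)
  have inj: "inj_on h V'" using h by (simp add: V'_def bij_betw_def)
  have im: "h ` V' = V" using h by (simp add: V'_def bij_betw_def)
  have 1: "finite_simple_graph V' E'"
    using simple unfolding finite_simple_graph_def E'_def V'_def by blast
  have 2: "unit_distance_graph d V' E'"
  proof -
    obtain p where p: "inj_on p V" "\<forall>v\<in>V. in_Rd d (p v)"
      "\<forall>u\<in>V. \<forall>v\<in>V. E u v \<longrightarrow> dist_Rd d (p u) (p v) = 1"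
      using unit by (auto simp: unit_distance_graph_def)
    then have "inj_on (p \<circ> h) V'" using inj im by (simp add: comp_inj_on)
    then show ?thesis unfolding unit_distance_graph_def
      using p hV by (intro exI[of _ "p \<circ> h"]) (auto simp: E'_def)
  qed
  have 3: "girth_at_least V' E' g"
    unfolding girth_at_least_def
  proof (intro allI impI notI)
    fix k assume k: "k < g" "has_cycle_of_length V' E' k"
    then obtain vs where vs: "3 \<le> k" "length vs = k" "distinct vs" "set vs \<subseteq> V'"
      "\<forall>i<k. E' (vs ! i) (vs ! ((i + 1) mod k))" by (auto simp: has_cycle_of_length_def)
    have "has_cycle_of_length V E k"
      unfolding has_cycle_of_length_def
    proof (intro conjI exI[of _ "map h vs"] allI impI)
      show "distinct (map h vs)" using vs inj by (auto simp: distinct_map intro: inj_on_subset)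
      show "set (map h vs) \<subseteq> V" using vs hV by auto
      fix i assume i: "i < k"
      then have "(i + 1) mod k < k" by (intro mod_less_divisor) auto
      then show "E (map h vs ! i) (map h vs ! ((i + 1) mod k))" using vs i by (simp add: E'_def)
    qed (use vs in auto)
    with k girth show False by (auto simp: girth_at_least_def)
  qed
  have 4: "colorable V E K" if K: "colorable V' E' K" for K
  proof -
    obtain c where c: "\<forall>v\<in>V'. c v < K" "\<forall>u\<in>V'. \<forall>v\<in>V'. E' u v \<longrightarrow> c u \<noteq> c v"
      using K by (auto simp: colorable_def)
    have inv: "inv_into V' h v \<in> V'" "h (inv_into V' h v) = v" if "v \<in> V" for v
      using that im by (metis inv_into_into, metis f_inv_into_f)
    show ?thesis unfolding colorable_def
      using c inv by (intro exI[of _ "c \<circ> inv_into V' h"]) (auto simp: E'_def)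
  qed
  show thesis using that 1 2 3 4 by blast
qed

text \<open>Sparsify a high Cartesian power. The factor 4 arises from keeping more than half of the
  vertices and from bounding independent sets by twice \<open>a * card W ^ (m - 1)\<close>.\<close>

lemma sparse_unit_distance_graph_of_independence_ratio:
  fixes W :: "'a set" and z :: "'a \<Rightarrow> nat \<Rightarrow> complex"
  assumes W: "finite W" "W \<noteq> {}" and a: "0 < a"
    and sym: "\<And>u v. E u v \<Longrightarrow> E v u" and irr: "\<And>u. \<not> E u u"
    and indep: "\<And>B. B \<subseteq> W \<Longrightarrow> a < card B \<Longrightarrow> \<exists>u\<in>B. \<exists>v\<in>B. E u v"
    and inj: "inj_on z W" and supp: "\<And>x j. x \<in> W \<Longrightarrow> k \<le> j \<Longrightarrow> z x j = 0"
    and unit: "\<And>x y. x \<in> W \<Longrightarrow> y \<in> W \<Longrightarrow> E x y \<Longrightarrow> (\<Sum>j<k. (cmod (z x j - z y j))\<^sup>2) = 1"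
    and d: "2 * k \<le> d"
  shows "\<exists>(V :: nat set) E. finite_simple_graph V E \<and> unit_distance_graph d V E \<and>
    girth_at_least V E g \<and> card W \<le> 4 * a * chromatic_number V E"
proof -
  define N where "N = card W"
  have N: "0 < N" using W by (simp add: N_def card_gt_0_iff)
  \<comment> \<open>Chosen so that \<open>C * a * N ^ (m - 1) = 8 * N ^ m\<close>, the density that
    sparsification requires.\<close>
  define C where "C = 8 * real N / real a"
  have C: "0 < C" using N a by (simp add: C_def)
  define S where "S = (\<Sum>k=3..<g. real N ^ (k - 1) * C ^ k)"
  \<comment> \<open>\<open>C \<le> m\<close> makes \<open>p\<close> a probability;
    \<open>8 * S \<le> m\<close> makes short cycles rare, since their weighted count is
    \<open>S / m\<close>.\<close>
  obtain m :: nat where m: "max 1 (max C (8 * S)) \<le> real m" using real_arch_simple by blast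
  then have m1: "1 \<le> real m" "C \<le> real m" "8 * S \<le> real m" by auto
  define p where "p = C / real m"
  define V where "V = cart_pow W m"
  define D where "D = m * N"
  define s where "s = 2 * real a * real N ^ (m - 1)"
  have finV: "finite V" unfolding V_def by (rule finite_cart_pow[OF W(1)])
  have cV: "card V = N ^ m" unfolding V_def N_def by (rule card_cart_pow[OF W(1)])
  then have V0: "V \<noteq> {}" using N by auto
  have Nm: "real N ^ m = real N * real N ^ (m - 1)" using m1 by (cases m) auto
  have p: "0 \<le> p" "p \<le> 1" using C m1 by (auto simp: p_def)
  have deg: "card {u\<in>V. cart_adj E u v} \<le> D" if "v \<in> V" for v
    using card_cart_adj_le[OF W(1), of v m E] that by (simp add: V_def D_def N_def)
  have dense: "8 * real (card V) \<le> p * real (card (arcs (cart_adj E) A))"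
    if A: "A \<subseteq> V" "s \<le> real (card A)" for A
  proof -
    have "card W * m * card A \<le> card W * card (arcs (cart_adj E) A) + m * a * card W ^ m"
      by (rule card_arcs_cart_pow[OF W(1) irr indep]) (use A V_def in auto)
    then have "real (N * m * card A) \<le> real (N * card (arcs (cart_adj E) A) + m * a * N ^ m)"
      unfolding N_def by (rule of_nat_mono)
    then have "real N * (real m * real (card A)) \<le>
        real N * (real (card (arcs (cart_adj E) A)) + real m * real a * real N ^ (m - 1))"
      by (simp add: Nm algebra_simps)
    then have "real m * real (card A) \<le>
        real (card (arcs (cart_adj E) A)) + real m * real a * real N ^ (m - 1)"
      using N by (simp only: mult_le_cancel_left)
    moreover have "real m * s \<le> real m * real (card A)" using A(2) by (intro mult_left_mono) auto
    ultimately have "real m * real a * real N ^ (m - 1) \<le> real (card (arcs (cart_adj E) A))"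
      by (simp add: s_def)
    then have "p * (real m * real a * real N ^ (m - 1)) \<le> p * real (card (arcs (cart_adj E) A))"
      using p by (intro mult_left_mono)
    moreover have "p * (real m * real a * real N ^ (m - 1)) = 8 * real N ^ m"
      using m1 a unfolding Nm by (simp add: p_def C_def)
    ultimately show ?thesis by (simp add: cV)
  qed
  have "(\<Sum>k=3..<g. real D ^ (k - 1) * p ^ k) = (\<Sum>k=3..<g. real N ^ (k - 1) * C ^ k / real m)"
  proof (rule sum.cong[OF refl])
    fix k assume "k \<in> {3..<g}"
    \<comment> \<open>There is one more factor \<open>p\<close> than \<open>D\<close>, which leaves
      a single division by \<open>m\<close>.\<close>
    then obtain l where "k = Suc l" by (cases k) auto
    then show "real D ^ (k - 1) * p ^ k = real N ^ (k - 1) * C ^ k / real m"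
      using m1 by (simp add: D_def p_def power_mult_distrib power_divide)
  qed
  then have short: "8 * (\<Sum>k=3..<g. real D ^ (k - 1) * p ^ k) \<le> 1"
    using m1 by (simp add: S_def flip: sum_divide_distrib)
  obtain U E' where U: "U \<subseteq> V" "card V < 2 * card U"
    and E': "\<And>u v. E' u v \<Longrightarrow> u \<in> U \<and> v \<in> U \<and> cart_adj E u v" "\<And>u v. E' u v \<Longrightarrow> E' v u"
    and girth: "girth_at_least U E' g"
    and hit: "\<And>A. A \<subseteq> U \<Longrightarrow> s \<le> real (card A) \<Longrightarrow> \<exists>u\<in>A. \<exists>v\<in>A. E' u v"
    by (rule exists_sparse_subgraph[OF finV V0 cart_adj_sym[OF sym] p deg dense short]) blast+
  have finU: "finite U" using U finV finite_subset by blast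
  have irr': "\<not> cart_adj E u u" for u by (rule cart_adj_irrefl) (rule irr)
  have simple: "finite_simple_graph U E'"
    using finU E' irr' unfolding finite_simple_graph_def by metis
  obtain cs where cs: "length cs = m" "\<forall>c\<in>set cs. cmod c = 1" "inj_on (position z cs) V"
    using exists_injective_position[OF W(1) inj supp] unfolding V_def by blast
  have pos0: "position z cs xs j = 0" if "xs \<in> V" "k \<le> j" for xs j
    by (rule position_eq_0[of W]) (use that supp in \<open>auto simp: V_def cart_pow_def\<close>)
  have "unit_distance_graph d U E'"
    unfolding unit_distance_graph_def
  proof (intro exI[of _ "realify \<circ> position z cs"] conjI ballI impI)
    show "inj_on (realify \<circ> position z cs) U"
      using cs(3) U(1) inj_realify by (meson comp_inj_on inj_on_subset subset_UNIV)
    show "in_Rd d ((realify \<circ> position z cs) v)" if "v \<in> U" for v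
      unfolding in_Rd_def using that U d pos0[of v] by (auto simp: realify_def)
    show "dist_Rd d ((realify \<circ> position z cs) u) ((realify \<circ> position z cs) v) = 1"
      if "u \<in> U" "v \<in> U" "E' u v" for u v
    proof -
      have uv: "u \<in> V" "v \<in> V" using that U by auto
      have "(\<Sum>j<k. (cmod (position z cs u j - position z cs v j))\<^sup>2) = 1"
        by (rule position_adjacent_dist[of W E])
          (use unit cs uv E'(1)[OF that(3)] in \<open>auto simp: V_def cart_pow_def\<close>)
      then show ?thesis using dist_realify[of k "position z cs u" "position z cs v" d] uv pos0 d by simp
    qed
  qed
  then obtain V' :: "nat set" and E'' where G: "finite_simple_graph V' E''"
    "unit_distance_graph d V' E''" "girth_at_least V' E'' g"
    and col: "\<And>K. colorable V' E'' K \<Longrightarrow> colorable U E' K"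
    using transfer_graph_to_nat[OF simple _ girth] by metis
  define K where "K = chromatic_number V' E''"
  have "colorable V' E'' K"
    unfolding K_def using G(1) unfolding finite_simple_graph_def
    by (intro colorable_chromatic_number) blast+
  then have "real (card U) \<le> real K * s"
    by (intro card_le_colors_mult_independence[OF col] hit)
  moreover have "real N * real N ^ (m - 1) < 2 * real (card U)"
    using U(2) unfolding cV Nm[symmetric] by (metis of_nat_less_iff of_nat_mult of_nat_numeral of_nat_power)
  ultimately have "real N * real N ^ (m - 1) < (4 * real a * real K) * real N ^ (m - 1)"
    by (simp add: s_def algebra_simps)
  then have "real N < 4 * real a * real K" by (rule mult_right_less_imp_less) simp
  then have "real (card W) \<le> real (4 * a * chromatic_number V' E'')" by (simp add: N_def K_def)
  then have "card W \<le> 4 * a * chromatic_number V' E''" by linarith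
  with G show ?thesis by blast
qed

section \<open>The base graph\<close>

text \<open>The indicator vector of \<open>A\<close> scaled by \<open>r\<close>, with consecutive
  real coordinates paired into complex ones.\<close>

definition cube_point :: "real \<Rightarrow> nat set \<Rightarrow> nat \<Rightarrow> complex" where
  "cube_point r A j = Complex (r * of_bool (2 * j \<in> A)) (r * of_bool (2 * j + 1 \<in> A))"

lemma inj_cube_point:
  assumes "r \<noteq> 0"
  shows "inj (cube_point r)"
proof (rule injI)
  fix A B assume eq: "cube_point r A = cube_point r B"
  have "i \<in> A \<longleftrightarrow> i \<in> B" for i
    using fun_cong[OF eq, of "i div 2"] assms
    by (cases "even i") (auto simp: cube_point_def of_bool_def elim!: oddE split: if_splits)
  then show "A = B" by blast
qed

lemma sum_cube_point:
  "(\<Sum>j<k. (cmod (cube_point r A j - cube_point r B j))\<^sup>2) = r\<^sup>2 * real (card ({..<2 * k} \<inter> (A - B \<union> (B - A))))"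
proof -
  have "(\<Sum>j<k. (cmod (cube_point r A j - cube_point r B j))\<^sup>2) =
      (\<Sum>i<2 * k. r\<^sup>2 * of_bool (i \<in> A - B \<union> (B - A)))"
    by (induction k) (auto simp: cube_point_def cmod_power2)
  also have "\<dots> = r\<^sup>2 * real (card ({..<2 * k} \<inter> (A - B \<union> (B - A))))"
    by (simp only: sum_distrib_left[symmetric]) (simp add: of_bool_def sum.If_cases Int_def del: Un_iff Diff_iff)
  finally show ?thesis .
qed

text \<open>The Frankl-Wilson graph serves as base graph; the divisor 4 is the loss from
  sparsification.\<close>

lemma exists_unit_distance_graph_exponential:
  assumes d: "8 \<le> d"
  shows "\<exists>(V :: nat set) E. finite_simple_graph V E \<and> unit_distance_graph d V E \<and>
    girth_at_least V E g \<and> (1.09::real) ^ (d - 1) / 4 \<le> real (chromatic_number V E)"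
proof -
  \<comment> \<open>Complex coordinates need an even ground set size \<open>n\<close>, which costs
    one in the exponent when \<open>d\<close> is odd.\<close>
  define k where "k = d div 2"
  define n where "n = 2 * k"
  have n: "7 \<le> n" "d - 1 \<le> n" "n \<le> d" using d by (auto simp: n_def k_def)
  obtain e q where q: "q = (2::nat) ^ e" and qn: "2 * q - 1 \<le> n"
    and ratio: "(1.09::real) ^ n * real (n choose (q - 1)) \<le> real (n choose (2 * q - 1))"
    using exponential_binomial_ratio[OF n(1)] by blast
  have q0: "0 < q" using q by simp
  define W where "W = {A. A \<subseteq> {..<n} \<and> card A = 2 * q - 1}"
  define E where "E A B \<longleftrightarrow> A \<noteq> B \<and> card (A \<inter> B) = q - 1" for A B :: "nat set"
  \<comment> \<open>Adjacent sets have a symmetric difference of size \<open>2 * q\<close>, so this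
    scaling gives distance 1.\<close>
  define r where "r = 1 / sqrt (2 * real q)"
  define a where "a = n choose (q - 1)"
  have finW: "finite W" unfolding W_def by simp
  have cW: "card W = n choose (2 * q - 1)" unfolding W_def using n_subsets[of "{..<n}"] by simp
  have W0: "W \<noteq> {}" using cW qn by (auto simp: binomial_eq_0_iff)
  have a0: "0 < a" unfolding a_def using qn by simp
  have "\<exists>(V :: nat set) E. finite_simple_graph V E \<and> unit_distance_graph d V E \<and>
    girth_at_least V E g \<and> card W \<le> 4 * a * chromatic_number V E"
  proof (rule sparse_unit_distance_graph_of_independence_ratio[where E = E and z = "cube_point r" and k = k])
    show "\<exists>u\<in>B. \<exists>v\<in>B. E u v" if B: "B \<subseteq> W" "a < card B" for B
    proof (rule ccontr)
      assume "\<not> ?thesis"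
      then have "card B \<le> a" unfolding a_def
        by (intro card_forbidden_intersection_le[OF q]) (use B in \<open>auto simp: W_def E_def\<close>)
      with B show False by simp
    qed
    have "r \<noteq> 0" using q0 by (simp add: r_def)
    then show "inj_on (cube_point r) W" using inj_cube_point inj_on_subset by blast
    show "cube_point r A j = 0" if "A \<in> W" "k \<le> j" for A j
      using that by (auto simp: W_def n_def cube_point_def complex_eq_iff)
    show "(\<Sum>j<k. (cmod (cube_point r A j - cube_point r B j))\<^sup>2) = 1"
      if A: "A \<in> W" and B: "B \<in> W" and AB: "E A B" for A B
    proof -
      have fin: "finite A" "finite B" using A B finite_subset[of _ "{..<n}"] by (auto simp: W_def)
      have c: "card A = 2 * q - 1" "card B = 2 * q - 1" "card (A \<inter> B) = q - 1" "card (B \<inter> A) = q - 1"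
        using A B AB by (simp_all add: W_def E_def Int_commute)
      have "card (A - B) = q" "card (B - A) = q"
        using card_Diff_subset_Int[of A B] card_Diff_subset_Int[of B A] fin c q0 by simp_all
      then have "card (A - B \<union> (B - A)) = 2 * q"
        using fin by (subst card_Un_disjoint) auto
      moreover have "{..<2 * k} \<inter> (A - B \<union> (B - A)) = A - B \<union> (B - A)"
        using A B by (auto simp: W_def n_def)
      ultimately show ?thesis using q0 by (simp add: sum_cube_point r_def power_divide)
    qed
    show "E B A" if "E A B" for A B using that by (auto simp: E_def Int_commute)
    show "2 * k \<le> d" by (simp add: k_def)
  qed (simp_all add: finW W0 a0 E_def)
  then obtain V :: "nat set" and E where G: "finite_simple_graph V E" "unit_distance_graph d V E"
    "girth_at_least V E g" and chi: "card W \<le> 4 * a * chromatic_number V E" by blast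
  have "(1.09::real) ^ (d - 1) * real a \<le> 1.09 ^ n * real a"
    using n by (intro mult_right_mono power_increasing) auto
  also have "\<dots> \<le> real (card W)" using ratio by (simp add: cW a_def)
  also have "\<dots> \<le> real (4 * a * chromatic_number V E)" using chi by (rule of_nat_mono)
  finally have "(1.09::real) ^ (d - 1) * real a \<le> 4 * real (chromatic_number V E) * real a"
    by (simp add: mult_ac)
  then have "(1.09::real) ^ (d - 1) \<le> 4 * real (chromatic_number V E)"
    using a0 by (simp only: mult_le_cancel_right)
  with G show ?thesis by (intro exI[of _ V] exI[of _ E]) simp
qed

theorem theorem1p1:
  shows "\<exists>\<epsilon> :: nat \<Rightarrow> real. \<epsilon> \<longlonglongrightarrow> 0 \<and>
    (\<forall>g d :: nat. 3 \<le> g \<longrightarrow> 1 \<le> d \<longrightarrow>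
      (\<exists>(V :: nat set) (E :: nat \<Rightarrow> nat \<Rightarrow> bool).
         finite_simple_graph V E \<and> unit_distance_graph d V E \<and>
         girth_at_least V E g \<and>
         real (chromatic_number V E) \<ge> (1.074 + \<epsilon> d) ^ d))"
proof -
  \<comment> \<open>4.36 is \<open>4 * 1.09\<close>: the gap between the bases 1.09 and 1.074
    absorbs the divisor 4 and the exponent \<open>d - 1\<close>.\<close>
  obtain D0 :: nat where D0: "(4.36::real) < (1.09 / 1.074) ^ D0"
    using real_arch_pow[of "1.09 / 1.074" "4.36"] by auto
  \<comment> \<open>For the finitely many small \<open>d\<close> the base becomes 0; as
    \<open>d\<close> is positive the bound is then 0 and the empty graph meets it.\<close>
  define \<epsilon> :: "nat \<Rightarrow> real" where "\<epsilon> d = (if d < max 8 D0 then - 1.074 else 0)" for d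
  have "eventually (\<lambda>d. \<epsilon> d = 0) sequentially"
    using eventually_ge_at_top[of "max 8 D0"] by eventually_elim (auto simp: \<epsilon>_def)
  then have "\<epsilon> \<longlonglongrightarrow> 0" by (rule tendsto_eventually)
  moreover have "\<exists>(V :: nat set) E. finite_simple_graph V E \<and> unit_distance_graph d V E \<and>
         girth_at_least V E g \<and> real (chromatic_number V E) \<ge> (1.074 + \<epsilon> d) ^ d"
    if "1 \<le> d" for g d
  proof (cases "d < max 8 D0")
    case True
    have "finite_simple_graph {} (\<lambda>u v :: nat. False)" by (simp add: finite_simple_graph_def)
    moreover have "unit_distance_graph d {} (\<lambda>u v :: nat. False)"
      by (simp add: unit_distance_graph_def)
    moreover have "\<not> has_cycle_of_length {} (\<lambda>u v :: nat. False) k" for k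
      by (auto simp: has_cycle_of_length_def)
    then have "girth_at_least {} (\<lambda>u v :: nat. False) g" by (simp add: girth_at_least_def)
    moreover have "(1.074 + \<epsilon> d) ^ d = 0" using True that by (simp add: \<epsilon>_def)
    ultimately show ?thesis by (metis of_nat_0_le_iff)
  next
    case False
    then have "8 \<le> d" "D0 \<le> d" by auto
    obtain V :: "nat set" and E where G: "finite_simple_graph V E" "unit_distance_graph d V E"
      "girth_at_least V E g" and chi: "(1.09::real) ^ (d - 1) / 4 \<le> real (chromatic_number V E)"
      using exists_unit_distance_graph_exponential[OF \<open>8 \<le> d\<close>, of g] by blast
    have "(4.36::real) \<le> (1.09 / 1.074) ^ d"
      by (rule less_imp_le[OF less_le_trans[OF D0 power_increasing[OF \<open>D0 \<le> d\<close>]]]) simp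
    then have "4.36 * (1.074::real) ^ d \<le> (1.09 / 1.074) ^ d * 1.074 ^ d"
      by (rule mult_right_mono) simp
    also have "\<dots> = 1.09 ^ d" by (simp flip: power_mult_distrib)
    also have "(1.09::real) ^ d = 1.09 * 1.09 ^ (d - 1)" using that by (cases d) auto
    finally have "(1.074::real) ^ d \<le> 1.09 ^ (d - 1) / 4" by simp
    with chi have "(1.074 + \<epsilon> d) ^ d \<le> real (chromatic_number V E)" using False by (simp add: \<epsilon>_def)
    with G show ?thesis by blast
  qed
  ultimately show ?thesis by blast
qed

end
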